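(* Let $M$ be an infinite complete metric space which is not uniformly discrete (with an arbitrary distinguished point $0\in M$). Then the set $\operatorname{SNA}(M)$ contains an isometric copy of $c_0$.
   Context: All vector spaces are real. Let $(M,d)$ be a pointed metric space, i.e. a metric space with a distinguished point $0\in M$ (its choice is irrelevant, since $f\mapsto f-f(0)$ is a linear isometry between the corresponding spaces preserving strong norm attainment). $\operatorname{Lip}_0(M)$ is the Banach space of all Lipschitz functions $f:M\to\mathbb{R}$ with $f(0)=0$, with norm $\|f\|_{\operatorname{Lip}}=\sup\{|f(y)-f(x)|/d(x,y): x,y\in M,\ x\ne y\}$. A function $f\in\operatorname{Lip}_0(M)$ strongly attains its norm if there are distinct $p,q\in M$ with $\|f\|_{\operatorname{Lip}}=|f(p)-f(q)|/d(p,q)$. $\operatorname{SNA}(M)\subseteq\operatorname{Lip}_0(M)$ is the set of all functions that strongly attain their norm. $\operatorname{SNA}(M)$ contains an isometric copy of a Banach space $Y$ if there is a linear isometric embedding $U:Y\to\operatorname{Lip}_0(M)$ with $U(Y)\subseteq\operatorname{SNA}(M)$. $c_0$ is the space of real sequences converging to $0$ with the supremum norm. With $R(x)=\inf\{d(x,y): y\in M\setminus\{x\}\}$, $M$ is uniformly discrete if $\inf\{R(x):x\in M\}>0$. *)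

theory Defs
  imports "HOL-Analysis.Analysis"
begin

text \<open>
  A metric space is the universe of a type \<open>'a\<close> of class \<open>metric_space\<close>; the
  distinguished point is an arbitrary element \<open>z :: 'a\<close>.
\<close>

definition Lip0 :: "'a::metric_space \<Rightarrow> ('a \<Rightarrow> real) set" where
  "Lip0 z = {f. f z = 0 \<and> (\<exists>L. L-lipschitz_on UNIV f)}"

text \<open>
  The supremum is that of the reals, so it is meaningful only for Lipschitz \<open>f\<close>
  on a space with at least two points (otherwise the set is unbounded or empty).
\<close>

definition lip_norm :: "('a::metric_space \<Rightarrow> real) \<Rightarrow> real" where
  "lip_norm f = Sup {\<bar>f y - f x\<bar> / dist x y | x y. x \<noteq> y}"

definition strongly_attains_norm :: "('a::metric_space \<Rightarrow> real) \<Rightarrow> bool" where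
  "strongly_attains_norm f \<longleftrightarrow> (\<exists>p q. p \<noteq> q \<and> lip_norm f = \<bar>f p - f q\<bar> / dist p q)"

definition SNA :: "'a::metric_space \<Rightarrow> ('a \<Rightarrow> real) set" where
  "SNA z = {f \<in> Lip0 z. strongly_attains_norm f}"

text \<open>
  \<open>Y\<close> is a linear subspace of a normed space. The function type \<open>'a \<Rightarrow> real\<close> is not an
  instance of \<open>real_vector\<close>, so linearity of \<open>U\<close> on \<open>Y\<close> is spelled out pointwise.
  For linear \<open>U\<close>, isometry means preservation of norms.
\<close>

definition linear_isometric_embedding ::
    "'b::real_normed_vector set \<Rightarrow> 'a::metric_space \<Rightarrow> ('b \<Rightarrow> 'a \<Rightarrow> real) \<Rightarrow> bool" where
  "linear_isometric_embedding Y z U \<longleftrightarrow>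
     (\<forall>u\<in>Y. U u \<in> Lip0 z) \<and>
     (\<forall>u\<in>Y. \<forall>v\<in>Y. U (u + v) = (\<lambda>t. U u t + U v t)) \<and>
     (\<forall>c. \<forall>u\<in>Y. U (c *\<^sub>R u) = (\<lambda>t. c * U u t)) \<and>
     (\<forall>u\<in>Y. lip_norm (U u) = norm u)"

definition SNA_contains_isometric_copy ::
    "'a::metric_space \<Rightarrow> 'b::real_normed_vector set \<Rightarrow> bool" where
  "SNA_contains_isometric_copy z Y \<longleftrightarrow>
     (\<exists>U. linear_isometric_embedding Y z U \<and> U ` Y \<subseteq> SNA z)"

text \<open>
  Every real sequence is continuous on the discrete space \<open>nat\<close>, so
  \<open>nat \<Rightarrow>\<^sub>C real\<close> is the space of bounded sequences with the supremum norm.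
\<close>

definition c0 :: "(nat \<Rightarrow>\<^sub>C real) set" where
  "c0 = {x. apply_bcontfun x \<longlonglongrightarrow> 0}"

definition isolation_radius :: "'a::metric_space \<Rightarrow> real" where
  "isolation_radius x = Inf {dist x y | y. y \<noteq> x}"

definition uniformly_discrete_space :: "'a::metric_space itself \<Rightarrow> bool" where
  "uniformly_discrete_space _ \<longleftrightarrow> Inf (range (isolation_radius :: 'a \<Rightarrow> real)) > 0"

end

theory Submission
  imports Defs
begin

text \<open>
  Tents \<open>t\<^sub>i = max 0 (\<rho>\<^sub>i - dist c\<^sub>i)\<close> with \<open>\<rho>\<^sub>i + \<rho>\<^sub>j \<le> dist c\<^sub>i c\<^sub>j\<close> for \<open>i \<noteq> j\<close> combine
  without raising the Lipschitz constant: \<open>\<Sum> b\<^sub>i t\<^sub>i\<close> has constant \<open>sup \<bar>b\<^sub>i\<bar>\<close>. Hence \<open>c\<^sub>0\<close> embeds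
  as soon as there are pairs \<open>x\<^sub>n, y\<^sub>n\<close> carrying such tents with \<open>\<rho>\<^sub>n + \<sigma>\<^sub>n = dist x\<^sub>n y\<^sub>n\<close>, the
  second one taken with opposite sign: a sequence in \<open>c\<^sub>0\<close> attains its norm at some \<open>n\<close>, and then
  the function attains its Lipschitz norm at \<open>(x\<^sub>n, y\<^sub>n)\<close>.

  If there is a limit point \<open>p\<close>, consider \<open>\<epsilon>(x, y) = dist x p + dist y p - dist x y\<close>. When
  \<open>\<epsilon>\<close> vanishes on pairs of distinct points close to \<open>p\<close>, take \<open>y\<^sub>n = p\<close>, \<open>\<rho>\<^sub>n = dist x\<^sub>n p\<close>,
  \<open>\<sigma>\<^sub>n = 0\<close>. Otherwise choose pairs with \<open>\<epsilon>(x\<^sub>n, y\<^sub>n) > 0\<close> converging to \<open>p\<close> so fast that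
  later points are within \<open>\<epsilon>(x\<^sub>n, y\<^sub>n) / 4\<close> of \<open>p\<close>, with radii the distances to \<open>p\<close> reduced
  by \<open>\<epsilon>(x\<^sub>n, y\<^sub>n) / 2\<close>. If there is no limit point, completeness turns pairs at distances
  tending to \<open>0\<close> into pairs with uniformly separated \<open>x\<^sub>n\<close>, and \<open>\<sigma>\<^sub>n = 0\<close> works again.
\<close>

section \<open>Sums of separated tents\<close>

text \<open>Only the open balls containing \<open>u\<close> are summed over. Once the tents are
  separated there is at most one, so no question of convergence arises.\<close>

definition tent_sum :: "('i \<Rightarrow> 'a::metric_space) \<Rightarrow> ('i \<Rightarrow> real) \<Rightarrow> ('i \<Rightarrow> real) \<Rightarrow> 'a \<Rightarrow> real" where
  "tent_sum c \<rho> b u = (\<Sum>i | dist u (c i) < \<rho> i. b i * (\<rho> i - dist u (c i)))"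

lemma tent_sum_add:
  "tent_sum c \<rho> (\<lambda>i. a i + b i) u = tent_sum c \<rho> a u + tent_sum c \<rho> b u"
  by (simp add: tent_sum_def sum.distrib distrib_right)

lemma tent_sum_scale:
  "tent_sum c \<rho> (\<lambda>i. k * b i) u = k * tent_sum c \<rho> b u"
  by (simp add: tent_sum_def sum_distrib_left mult.assoc)

text \<open>Radius 0 is allowed: such a center carries no tent but stays outside all other open
  balls, and centers of radius 0 may coincide.\<close>

locale separated_tents =
  fixes c :: "'i \<Rightarrow> 'a::metric_space" and \<rho> :: "'i \<Rightarrow> real"
  assumes radius_nonneg: "\<rho> i \<ge> 0"
    and separated: "i \<noteq> j \<Longrightarrow> \<rho> i + \<rho> j \<le> dist (c i) (c j)"
begin

lemma tent_unique:
  assumes "dist u (c i) < \<rho> i" and "dist u (c j) < \<rho> j"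
  shows "j = i"
proof (rule ccontr)
  assume "j \<noteq> i"
  then have "\<rho> i + \<rho> j \<le> dist (c i) (c j)"
    by (intro separated) simp
  then show False
    using assms dist_triangle3[of "c i" "c j" u] by linarith
qed

lemma tent_sum_eq_single:
  assumes "dist u (c i) < \<rho> i"
  shows "tent_sum c \<rho> b u = b i * (\<rho> i - dist u (c i))"
proof -
  have "{j. dist u (c j) < \<rho> j} = {i}"
    using tent_unique[OF assms] assms by blast
  then show ?thesis
    by (simp add: tent_sum_def)
qed

lemma tent_sum_eq_0:
  assumes "\<And>i. \<rho> i \<le> dist u (c i)"
  shows "tent_sum c \<rho> b u = 0"
proof -
  have "{j. dist u (c j) < \<rho> j} = {}"
    using assms by (auto simp: not_less)
  then show ?thesis
    by (simp add: tent_sum_def)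
qed

lemma tent_sum_center: "tent_sum c \<rho> b (c i) = b i * \<rho> i"
proof (cases "\<rho> i > 0")
  case True
  then show ?thesis
    using tent_sum_eq_single[of "c i" i b] by simp
next
  case False
  then have 0: "\<rho> i = 0"
    using radius_nonneg[of i] by simp
  have "\<rho> j \<le> dist (c i) (c j)" for j
    using separated[of i j] 0 by (cases "i = j") auto
  then show ?thesis
    using 0 by (simp add: tent_sum_eq_0)
qed

text \<open>Within one tent the distance function is 1-Lipschitz. For points in different balls,
  separation and the triangle inequality bound the sum of the two heights by
  \<open>dist u v\<close>.\<close>

lemma tent_sum_lipschitz:
  assumes b: "\<And>i. \<bar>b i\<bar> \<le> A"
  shows "\<bar>tent_sum c \<rho> b u - tent_sum c \<rho> b v\<bar> \<le> A * dist u v"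
proof -
  \<comment> \<open>Any index will do, since types are nonempty.\<close>
  have A: "A \<ge> 0"
    using b[of undefined] by linarith
  have scale: "\<bar>b i * r\<bar> \<le> A * s" if "\<bar>r\<bar> \<le> s" for i r s
    using mult_mono[OF b[of i] that A] by (simp add: abs_mult)
  have outside: "\<bar>tent_sum c \<rho> b u - tent_sum c \<rho> b v\<bar> \<le> A * dist u v"
    if v: "\<And>i. \<rho> i \<le> dist v (c i)" for u v
  proof (cases "\<exists>i. dist u (c i) < \<rho> i")
    case True
    then obtain i where i: "dist u (c i) < \<rho> i"
      by blast
    have "\<bar>\<rho> i - dist u (c i)\<bar> \<le> dist u v"
      using i v[of i] dist_triangle[of v "c i" u] by (simp add: dist_commute)
    then show ?thesis
      using scale tent_sum_eq_single[OF i] tent_sum_eq_0[OF v] by simp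
  next
    case False
    then show ?thesis
      using A v by (simp add: tent_sum_eq_0 not_less)
  qed
  consider (v) "\<And>i. \<rho> i \<le> dist v (c i)" | (u) "\<And>i. \<rho> i \<le> dist u (c i)"
    | (both) i j where "dist u (c i) < \<rho> i" "dist v (c j) < \<rho> j"
    by (meson not_less)
  then show ?thesis
  proof cases
    case v
    then show ?thesis
      by (rule outside)
  next
    case u
    then show ?thesis
      using outside[of u v] by (simp add: dist_commute abs_minus_commute)
  next
    case both
    show ?thesis
    proof (cases "i = j")
      case True
      have "\<bar>dist v (c i) - dist u (c i)\<bar> \<le> dist u v"
        using dist_triangle[of v "c i" u] dist_triangle[of u "c i" v]
        by (simp add: dist_commute abs_le_iff)
      then have "\<bar>b i * (dist v (c i) - dist u (c i))\<bar> \<le> A * dist u v"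
        by (rule scale)
      then show ?thesis
        using both True by (simp add: tent_sum_eq_single algebra_simps)
    next
      case False
      have "\<bar>tent_sum c \<rho> b u - tent_sum c \<rho> b v\<bar>
          \<le> A * (\<rho> i - dist u (c i)) + A * (\<rho> j - dist v (c j))"
        using scale[of "\<rho> i - dist u (c i)" "\<rho> i - dist u (c i)" i]
          scale[of "\<rho> j - dist v (c j)" "\<rho> j - dist v (c j)" j] both
        by (simp add: tent_sum_eq_single)
      also have "\<dots> = A * (\<rho> i + \<rho> j - dist u (c i) - dist v (c j))"
        by (simp add: algebra_simps)
      also have "\<dots> \<le> A * dist u v"
      proof (rule mult_left_mono[OF _ A])
        show "\<rho> i + \<rho> j - dist u (c i) - dist v (c j) \<le> dist u v"
          using separated[OF False] dist_triangle[of "c i" "c j" u] dist_triangle[of u "c j" v]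
          by (simp add: dist_commute)
      qed
      finally show ?thesis .
    qed
  qed
qed

end

section \<open>Norm attainment and a criterion for copies of \<open>c0\<close>\<close>

lemma lip_norm_eqI:
  assumes le: "\<And>u v. \<bar>f u - f v\<bar> \<le> A * dist u v"
    and "p \<noteq> q" and "\<bar>f p - f q\<bar> = A * dist p q"
  shows "lip_norm f = A"
  unfolding lip_norm_def
proof (rule cSup_eq_maximum)
  show "A \<in> {\<bar>f y - f x\<bar> / dist x y | x y. x \<noteq> y}"
    using assms(2,3)
    by (intro CollectI exI[of _ q] exI[of _ p]) (simp add: dist_commute)
next
  fix r
  assume "r \<in> {\<bar>f y - f x\<bar> / dist x y | x y. x \<noteq> y}"
  then show "r \<le> A"
    using le by (auto simp: divide_le_eq) (metis dist_commute)
qed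

lemma c0_attains_norm:
  assumes "a \<in> c0"
  obtains n where "\<bar>apply_bcontfun a n\<bar> = norm a"
proof (cases "norm a = 0")
  case True
  then show ?thesis
    using that[of 0] by simp
next
  case False
  then have pos: "norm a / 2 > 0"
    by simp
  moreover have "apply_bcontfun a \<longlonglongrightarrow> 0"
    using assms by (simp add: c0_def)
  ultimately obtain N where "\<forall>n\<ge>N. norm (apply_bcontfun a n - 0) < norm a / 2"
    using LIMSEQ_D by blast
  then have N: "\<bar>apply_bcontfun a n\<bar> < norm a / 2" if "n \<ge> N" for n
    using that by simp
  \<comment> \<open>The extra element \<open>norm a / 2\<close> bounds the tail. It lies below the
    norm, so the maximum must come from one of the first \<open>N\<close> terms.\<close>
  define S where "S = insert (norm a / 2) ((\<lambda>n. \<bar>apply_bcontfun a n\<bar>) ` {..<N})"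
  have S: "finite S" "S \<noteq> {}"
    by (auto simp: S_def)
  have "norm (apply_bcontfun a n) \<le> Max S" for n
  proof (cases "n < N")
    case True
    then show ?thesis
      using S by (auto simp: S_def intro!: Max_ge)
  next
    case False
    then have "\<bar>apply_bcontfun a n\<bar> \<le> norm a / 2"
      using N[of n] by simp
    also have "\<dots> \<le> Max S"
      using S(1) by (rule Max_ge) (simp add: S_def)
    finally show ?thesis
      by simp
  qed
  then have le: "norm a \<le> Max S"
    by (rule norm_bound)
  have "Max S \<in> S"
    using S by (rule Max_in)
  moreover have "Max S \<noteq> norm a / 2"
    using le pos by linarith
  ultimately obtain n where "Max S = \<bar>apply_bcontfun a n\<bar>"
    unfolding S_def by blast
  then show ?thesis
    using le norm_bounded[of a n] that[of n] by simp
qed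

lemma SNA_contains_c0I:
  fixes x y :: "nat \<Rightarrow> 'a::metric_space" and z :: 'a
  assumes nonneg: "\<And>n. \<rho> n \<ge> 0" "\<And>n. \<sigma> n \<ge> 0"
    and neq: "\<And>n. x n \<noteq> y n"
    and split: "\<And>n. \<rho> n + \<sigma> n = dist (x n) (y n)"
    and xx: "\<And>m n. m \<noteq> n \<Longrightarrow> \<rho> m + \<rho> n \<le> dist (x m) (x n)"
    and xy: "\<And>m n. m \<noteq> n \<Longrightarrow> \<rho> m + \<sigma> n \<le> dist (x m) (y n)"
    and yy: "\<And>m n. m \<noteq> n \<Longrightarrow> \<sigma> m + \<sigma> n \<le> dist (y m) (y n)"
  shows "SNA_contains_isometric_copy z c0"
proof -
  \<comment> \<open>The tag \<open>True\<close> marks the tents at \<open>x n\<close>,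
    \<open>False\<close> those at \<open>y n\<close>.\<close>
  define c where "c = (\<lambda>(n, s). if s then x n else y n)"
  define r where "r = (\<lambda>(n, s). if s then \<rho> n else \<sigma> n)"
  interpret separated_tents c r
  proof
    show "r i \<ge> 0" for i
      using nonneg by (cases i) (simp add: r_def)
  next
    fix i j :: "nat \<times> bool"
    assume "i \<noteq> j"
    obtain m s where i: "i = (m, s)"
      by (cases i)
    obtain n t where j: "j = (n, t)"
      by (cases j)
    show "r i + r j \<le> dist (c i) (c j)"
    proof (cases "m = n")
      case True
      then show ?thesis
        using \<open>i \<noteq> j\<close> split[of n] by (auto simp: i j r_def c_def dist_commute)
    next
      case False
      then show ?thesis
        using xx[of m n] xy[of m n] xy[of n m] yy[of m n]
        by (auto simp: i j r_def c_def dist_commute)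
    qed
  qed
  define b :: "(nat \<Rightarrow>\<^sub>C real) \<Rightarrow> nat \<times> bool \<Rightarrow> real"
    where "b = (\<lambda>a (n, s). if s then apply_bcontfun a n else - apply_bcontfun a n)"
  \<comment> \<open>Subtracting the value at \<open>z\<close> normalizes the function without
    changing its differences.\<close>
  define U where "U = (\<lambda>a t. tent_sum c r (b a) t - tent_sum c r (b a) z)"
  have b_add: "b (u + v) = (\<lambda>i. b u i + b v i)" for u v
    by (auto simp: b_def plus_bcontfun.rep_eq)
  have b_scale: "b (k *\<^sub>R u) = (\<lambda>i. k * b u i)" for k u
    by (auto simp: b_def scaleR_bcontfun.rep_eq)
  have lip: "\<bar>U a u - U a v\<bar> \<le> norm a * dist u v" for a u v
  proof -
    have "\<bar>b a i\<bar> \<le> norm a" for i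
      using norm_bounded[of a "fst i"] by (cases i) (simp add: b_def)
    from tent_sum_lipschitz[of "b a", OF this] show ?thesis
      by (simp add: U_def)
  qed
  have Lip0: "U a \<in> Lip0 z" for a
    using lip by (auto simp: Lip0_def U_def lipschitz_on_def dist_real_def intro!: exI[of _ "norm a"])
  \<comment> \<open>The opposite signs make the heights \<rho> and \<sigma> add up to the full
    distance.\<close>
  have pair: "U a (x n) - U a (y n) = apply_bcontfun a n * dist (x n) (y n)" for a n
    using tent_sum_center[of "b a" "(n, True)"] tent_sum_center[of "b a" "(n, False)"]
    by (simp add: U_def b_def c_def r_def flip: split) (simp add: algebra_simps)
  have attain: "\<exists>p q. p \<noteq> q \<and> \<bar>U a p - U a q\<bar> = norm a * dist p q" if "a \<in> c0" for a
  proof -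
    obtain n where "\<bar>apply_bcontfun a n\<bar> = norm a"
      using c0_attains_norm \<open>a \<in> c0\<close> by blast
    then show ?thesis
      using pair[of a n] neq[of n] by (metis abs_mult abs_of_nonneg zero_le_dist)
  qed
  have norm: "lip_norm (U a) = norm a" if "a \<in> c0" for a
    using attain[OF that] lip_norm_eqI[of "U a", OF lip] by blast
  have "linear_isometric_embedding c0 z U"
    unfolding linear_isometric_embedding_def
    by (auto simp: Lip0 norm) (auto simp: U_def b_add b_scale tent_sum_add tent_sum_scale algebra_simps)
  moreover have "strongly_attains_norm (U a)" if "a \<in> c0" for a
    using attain[OF that] unfolding strongly_attains_norm_def norm[OF that] by (force simp: field_simps)
  then have "U ` c0 \<subseteq> SNA z"
    using Lip0 by (auto simp: SNA_def)
  ultimately show ?thesis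
    unfolding SNA_contains_isometric_copy_def by blast
qed

section \<open>Spaces with a limit point\<close>

lemma SNA_contains_c0_if_limit_point:
  fixes p z :: "'a::metric_space"
  assumes p: "p islimpt UNIV"
  shows "SNA_contains_isometric_copy z c0"
proof -
  define \<epsilon> where "\<epsilon> x y = dist x p + dist y p - dist x y" for x y
  show ?thesis
  proof (cases "\<forall>r>0. \<exists>x y. x \<noteq> y \<and> dist x p < r \<and> dist y p < r \<and> \<epsilon> x y > 0")
    case True
    define E where "E s = \<epsilon> (fst s) (snd s)" for s
    have step: "\<exists>s. (fst s \<noteq> snd s \<and> E s > 0) \<and> dist (fst s) p < r \<and> dist (snd s) p < r"
      if "r > 0" for r
      using True[rule_format, OF that] by (auto simp: E_def)
    have "\<exists>f. \<forall>n. (fst (f n) \<noteq> snd (f n) \<and> E (f n) > 0) \<and>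
        (dist (fst (f (Suc n))) p < E (f n) / 4 \<and> dist (snd (f (Suc n))) p < E (f n) / 4)"
    proof (rule dependent_nat_choice)
      show "\<exists>s. fst s \<noteq> snd s \<and> E s > 0"
        using step[of 1] by auto
      show "\<exists>t. (fst t \<noteq> snd t \<and> E t > 0) \<and> (dist (fst t) p < E s / 4 \<and> dist (snd t) p < E s / 4)"
        if "fst s \<noteq> snd s \<and> E s > 0" for s
        using step[of "E s / 4"] that by simp
    qed
    then obtain f where f: "\<And>n. fst (f n) \<noteq> snd (f n)" "\<And>n. E (f n) > 0"
      "\<And>n. dist (fst (f (Suc n))) p < E (f n) / 4" "\<And>n. dist (snd (f (Suc n))) p < E (f n) / 4"
      by blast
    define x y e where "x = fst \<circ> f" and "y = snd \<circ> f" and "e = E \<circ> f"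
    have e: "e n = dist (x n) p + dist (y n) p - dist (x n) (y n)" "e n > 0" for n
      using f(2)[of n] by (simp_all add: e_def x_def y_def E_def \<epsilon>_def)
    have e_le: "e n \<le> 2 * dist (x n) p" "e n \<le> 2 * dist (y n) p" for n
      using dist_triangle[of "x n" p "y n"] dist_triangle[of "y n" p "x n"] e(1)[of n]
      by (simp_all add: dist_commute)
    have close_Suc: "dist (x (Suc n)) p < e n / 4" "dist (y (Suc n)) p < e n / 4" for n
      using f(3,4)[of n] by (simp_all add: x_def y_def e_def)
    \<comment> \<open>By \<open>e_le\<close> and the choice of the next pair, \<open>e\<close> at
      least halves at each step.\<close>
    have "decseq e"
    proof (rule decseq_SucI)
      show "e (Suc n) \<le> e n" for n
        using close_Suc(1)[of n] e_le(1)[of "Suc n"] e(2)[of n] by simp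
    qed
    have close: "dist (x n) p \<le> e m / 4" "dist (y n) p \<le> e m / 4" if "m < n" for m n
    proof -
      obtain k where k: "n = Suc k"
        using \<open>m < n\<close> by (cases n) auto
      then have "e k \<le> e m"
        using \<open>decseq e\<close> \<open>m < n\<close> by (simp add: decseqD)
      then show "dist (x n) p \<le> e m / 4" "dist (y n) p \<le> e m / 4"
        using close_Suc[of k] k by simp_all
    qed
    \<comment> \<open>Replacing \<open>dist u v\<close> by \<open>dist u p + dist v p\<close> costs
      at most \<open>2 * dist v p\<close>, hence at most \<open>e m / 2\<close>: the reduction of
      the earlier radius pays for it.\<close>
    have sep: "dist u p - e m / 2 + (dist v p - e n / 2) \<le> dist u v"
      if "m < n" "v \<in> {x n, y n}" for m n u v
    proof -
      have "dist v p \<le> e m / 4"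
        using close that by blast
      then show ?thesis
        using dist_triangle[of u p v] e(2)[of n] by simp
    qed
    have sep': "dist u p - e m / 2 + (dist v p - e n / 2) \<le> dist u v"
      if "m \<noteq> n" "u \<in> {x m, y m}" "v \<in> {x n, y n}" for m n u v
      using sep[of m n v u] sep[of n m u v] that
      by (cases "m < n") (simp_all add: dist_commute add.commute)
    show ?thesis
    proof (rule SNA_contains_c0I[where x = x and y = y
          and \<rho> = "\<lambda>n. dist (x n) p - e n / 2" and \<sigma> = "\<lambda>n. dist (y n) p - e n / 2"])
      show "dist (x n) p - e n / 2 + (dist (y n) p - e n / 2) = dist (x n) (y n)" for n
        using e(1)[of n] by simp
      show "x n \<noteq> y n" for n
        using f(1)[of n] by (simp add: x_def y_def)
      show "dist (x n) p - e n / 2 \<ge> 0" "dist (y n) p - e n / 2 \<ge> 0" for n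
        using e_le[of n] by simp_all
    qed (use sep' in auto)
  next
    case False
    then obtain r where r: "r > 0"
      "\<And>x y. x \<noteq> y \<Longrightarrow> dist x p < r \<Longrightarrow> dist y p < r \<Longrightarrow> \<epsilon> x y \<le> 0"
      by (meson not_less)
    have "infinite (UNIV \<inter> ball p r)"
      using p r(1) islimpt_eq_infinite_ball by blast
    then have "infinite (ball p r - {p})"
      by simp
    then obtain x :: "nat \<Rightarrow> 'a" where x: "inj x" "range x \<subseteq> ball p r - {p}"
      using infinite_countable_subset by blast
    then have x_close: "dist (x n) p < r" "x n \<noteq> p" for n
      by (auto simp: dist_commute image_subset_iff)
    \<comment> \<open>Near \<open>p\<close>, any two distinct points have \<open>p\<close>
      metrically between them, so the balls reaching to \<open>p\<close> do not overlap.\<close>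
    have "dist (x m) p + dist (x n) p \<le> dist (x m) (x n)" if "m \<noteq> n" for m n
      using r(2)[of "x m" "x n"] x_close x(1) that by (auto simp: \<epsilon>_def inj_eq)
    then show ?thesis
      using x_close
      by (intro SNA_contains_c0I[where x = x and y = "\<lambda>_. p"
          and \<rho> = "\<lambda>n. dist (x n) p" and \<sigma> = "\<lambda>_. 0"]) auto
  qed
qed

section \<open>Complete spaces without limit points\<close>

lemma SNA_contains_c0_if_no_limit_point:
  fixes z :: "'a::complete_space"
  assumes no_limit: "\<And>p::'a. \<not> p islimpt UNIV"
    and near: "\<And>r. r > 0 \<Longrightarrow> \<exists>x y::'a. x \<noteq> y \<and> dist x y < r"
  shows "SNA_contains_isometric_copy z c0"
proof -
  have "\<exists>x y::'a. x \<noteq> y \<and> dist x y < inverse (real (Suc n))" for n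
    by (rule near) simp
  then obtain x y :: "nat \<Rightarrow> 'a"
    where xy: "\<And>n. x n \<noteq> y n" "\<And>n. dist (x n) (y n) < inverse (real (Suc n))"
    by metis
  have small: "\<exists>N. \<forall>n\<ge>N. dist (x n) (y n) < r" if "r > 0" for r
  proof -
    obtain N where N: "inverse (real (Suc N)) < r"
      using reals_Archimedean \<open>r > 0\<close> by blast
    have "dist (x n) (y n) < r" if "n \<ge> N" for n
    proof -
      have "inverse (real (Suc n)) \<le> inverse (real (Suc N))"
        using that by (intro le_imp_inverse_le) auto
      then show ?thesis
        using xy(2)[of n] N by linarith
    qed
    then show ?thesis
      by blast
  qed
  have "\<not> compact (range x)"
  proof
    assume "compact (range x)"
    then obtain p g where g: "strict_mono g" "(x \<circ> g) \<longlonglongrightarrow> p"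
      unfolding compact_def by blast
    \<comment> \<open>Both \<open>x n\<close> and \<open>y n\<close> come close to \<open>p\<close>;
      being distinct, at least one of them differs from \<open>p\<close>.\<close>
    have "\<exists>u\<in>UNIV. u \<noteq> p \<and> dist u p < r" if "r > 0" for r
    proof -
      obtain N where N: "\<And>n. n \<ge> N \<Longrightarrow> dist (x n) (y n) < r / 2"
        using small[of "r / 2"] \<open>r > 0\<close> by auto
      obtain K where K: "\<And>n. n \<ge> K \<Longrightarrow> dist (x (g n)) p < r / 2"
        using g(2) \<open>r > 0\<close> unfolding LIMSEQ_def by (metis comp_apply half_gt_zero)
      define n where "n = g (max N K)"
      have "n \<ge> N"
        using seq_suble[OF g(1), of "max N K"] by (simp add: n_def)
      then have "dist (x n) (y n) < r / 2" "dist (x n) p < r / 2"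
        using N K by (simp_all add: n_def)
      then have "dist (x n) p < r" "dist (y n) p < r"
        using dist_triangle[of "y n" p "x n"] that by (simp_all add: dist_commute)
      then show ?thesis
        using xy(1)[of n] by (metis UNIV_I)
    qed
    then have "p islimpt UNIV"
      unfolding islimpt_approachable by blast
    then show False
      using no_limit by blast
  qed
  \<comment> \<open>Closed means complete here, so the failure of compactness is a failure of total
    boundedness, which yields an \<open>e\<close>-separated subsequence.\<close>
  moreover have "closed (range x)"
    unfolding closed_limpt using no_limit by (meson islimpt_subset subset_UNIV)
  ultimately have "\<not> (\<forall>e>0. \<exists>k. finite k \<and> range x \<subseteq> (\<Union>u\<in>k. ball u e))"
    by (simp add: compact_eq_totally_bounded complete_eq_closed)
  then obtain e where e: "e > 0"
    "\<And>k. finite k \<Longrightarrow> \<not> range x \<subseteq> (\<Union>u\<in>k. ball u e)"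
    by blast
  obtain N where N: "\<And>n. n \<ge> N \<Longrightarrow> dist (x n) (y n) < e / 2"
    using small[of "e / 2"] e(1) by auto
  define P where "P g n m \<longleftrightarrow> (\<forall>i<n. e \<le> dist (x (g i)) (x m)) \<and> N \<le> m"
    for g :: "nat \<Rightarrow> nat" and n m :: nat
  have "\<exists>g. \<forall>n. P g n (g n)"
  proof (rule dependent_wellorder_choice)
    show "P f n m = P g n m" if "\<And>i. i < n \<Longrightarrow> f i = g i" for f g n m
      using that by (simp add: P_def)
  next
    fix n :: nat and g :: "nat \<Rightarrow> nat"
    \<comment> \<open>Adding the first \<open>N\<close> points to the finite net forces the new
      index to be at least \<open>N\<close>.\<close>
    have "\<not> range x \<subseteq> (\<Union>u\<in>x ` ({..<N} \<union> g ` {..<n}). ball u e)"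
      by (rule e(2)) simp
    then obtain m where m: "x m \<notin> (\<Union>u\<in>x ` ({..<N} \<union> g ` {..<n}). ball u e)"
      by blast
    then have "x m \<notin> ball (x m) e" if "m < N"
      using that by blast
    then have "N \<le> m"
      using e(1) by (meson centre_in_ball not_less)
    moreover have "e \<le> dist (x (g i)) (x m)" if "i < n" for i
    proof -
      have "x m \<notin> ball (x (g i)) e"
        using m that by blast
      then show ?thesis
        by simp
    qed
    ultimately show "\<exists>m. P g n m"
      unfolding P_def by blast
  qed
  then obtain g where "\<And>n. P g n (g n)"
    by blast
  then have g: "\<And>i n. i < n \<Longrightarrow> e \<le> dist (x (g i)) (x (g n))" "\<And>n. N \<le> g n"
    by (simp_all add: P_def)
  have sep: "e \<le> dist (x (g m)) (x (g n))" if "m \<noteq> n" for m n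
    using g(1)[of m n] g(1)[of n m] that by (metis dist_commute linorder_neqE_nat)
  \<comment> \<open>Radii below \<open>e / 2\<close> fit the separation \<open>e\<close> of the
    centers, and each \<open>y (g n)\<close> stays more than \<open>e / 2\<close> away from the
    other centers.\<close>
  have half: "dist (x (g n)) (y (g n)) < e / 2" for n
    using N g(2) by blast
  show ?thesis
  proof (rule SNA_contains_c0I[where x = "x \<circ> g" and y = "y \<circ> g"
        and \<rho> = "\<lambda>n. dist (x (g n)) (y (g n))" and \<sigma> = "\<lambda>_. 0"])
    fix m n :: nat
    assume "m \<noteq> n"
    then show "dist (x (g m)) (y (g m)) + dist (x (g n)) (y (g n)) \<le> dist ((x \<circ> g) m) ((x \<circ> g) n)"
      using half[of m] half[of n] sep[of m n] by simp
    show "dist (x (g m)) (y (g m)) + 0 \<le> dist ((x \<circ> g) m) ((y \<circ> g) n)"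
      using half[of m] half[of n] sep[OF \<open>m \<noteq> n\<close>] dist_triangle[of "x (g m)" "x (g n)" "y (g n)"]
      by (simp add: dist_commute)
  qed (use xy(1) in auto)
qed

section \<open>Close pairs and the case distinction\<close>

lemma not_uniformly_discrete_pairs:
  assumes "infinite (UNIV :: 'a::metric_space set)"
    and "\<not> uniformly_discrete_space TYPE('a)" and "r > 0"
  shows "\<exists>x y::'a. x \<noteq> y \<and> dist x y < r"
proof -
  have "Inf (range (isolation_radius :: 'a \<Rightarrow> real)) < r"
    using assms(2,3) by (simp add: uniformly_discrete_space_def)
  then obtain x :: 'a where x: "isolation_radius x < r"
    using cInf_lessD by blast
  \<comment> \<open>A second point is needed: an infimum yields a witness only over a nonempty
    set.\<close>
  have "infinite (UNIV - {x})"
    using assms(1) by simp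
  then have "UNIV - {x} \<noteq> {}"
    by (rule infinite_imp_nonempty)
  then have "{dist x y | y. y \<noteq> x} \<noteq> {}"
    by blast
  from cInf_lessD[OF this x[unfolded isolation_radius_def]]
  show ?thesis
    by (elim bexE CollectE exE conjE) (metis)
qed

theorem theorem4p2:
  fixes z :: "'a::complete_space"
  assumes "infinite (UNIV :: 'a set)"
    and "\<not> uniformly_discrete_space TYPE('a)"
  shows "SNA_contains_isometric_copy z c0"
proof (cases "\<exists>p::'a. p islimpt UNIV")
  case True
  then show ?thesis
    using SNA_contains_c0_if_limit_point by blast
next
  case False
  show ?thesis
  proof (rule SNA_contains_c0_if_no_limit_point)
    show "\<not> p islimpt UNIV" for p :: 'a
      using False by blast
  qed (rule not_uniformly_discrete_pairs[OF assms])
qed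

end
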